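(* If $\sum_{k=1}^K\varepsilon_k\varepsilon_k'\neq 0$, then the optimization problem $$\max_{P_0}\ U_0(P_0,\tilde{\boldsymbol p}^* )=\max_{P_0}\left\{\ln\left(1+\frac{H_{00}P_0}{A-BP_0}\right)-\lambda_0P_0\right\}\quad\text{s.t.}\quad P_0^{\min}\le P_0\le P_0^{\max}$$ has an optimal solution $$\tilde P_0^*=\begin{cases}\arg\max\left\{U_0(P_0^{\max},\tilde{\boldsymbol p}^* ),\,U_0(P_0^{\min},\tilde{\boldsymbol p}^* )\right\}, & C_2^2-4C_1C_3<0,\\ \arg\max\left\{U_0(P_0^{\max},\tilde{\boldsymbol p}^* ),\,U_0(P_0^{\min},\tilde{\boldsymbol p}^* ),\,U_0(P_0^{1},\tilde{\boldsymbol p}^* ),\,U_0(P_0^{2},\tilde{\boldsymbol p}^* )\right\}, & C_2^2-4C_1C_3\ge 0,\end{cases}$$ where $\arg\max\{U_0(x_1,\tilde{\boldsymbol p}^* ),\dots,U_0(x_r,\tilde{\boldsymbol p}^* )\}$ means a point among $x_1,\dots,x_r$ at which $U_0(\cdot,\tilde{\boldsymbol p}^* )$ is largest, and $$C_1=\lambda_0B(H_{00}-B),\quad C_2=\lambda_0A(2B-H_{00}),\quad C_3=AH_{00}-\lambda_0A^2,$$ $$P_0^1=\frac{-C_2+\sqrt{C_2^2-4C_1C_3}}{2C_1},\qquad P_0^2=\frac{-C_2-\sqrt{C_2^2-4C_1C_3}}{2C_1}.$$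
   Context: A network has one macrocell user equipment (MUE, index $0$, the leader) and $K\ge 1$ small-cell user equipments (SUEs, indices $1,\dots,K$, the followers). The data are real numbers: channel gains $H_{ij}>0$ ($0\le i,j\le K$), where $H_{ij}$ is the gain from user $j$ to the base station of user $i$; noise power $N_0>0$; maximum transmit power $P_T>0$; cost coefficients $\lambda_0,\lambda_1,\dots,\lambda_K>0$. Write $(x)^+=\max(x,0)$. Followers' responses. Let $\bar P_0\in[0,P_T]$ be the current MUE power and let $\tilde{\boldsymbol p}^*=[\tilde P_1^*,\dots,\tilde P_K^*]^T$ be the SUEs' responses to it, i.e. for every $k$ $$\tilde P_k^*=P_T-\left[P_T-(P_k^{\rm tmp})^+\right]^+,\qquad P_k^{\rm tmp}=\frac1{\lambda_k}-\frac{N_0+H_{k0}\bar P_0+\sum_{k'\ne k,\,k'=1}^KH_{kk'}\tilde P_{k'}^*}{H_{kk}} .$$ Let $\varepsilon_k=1$ if $P_k^{\rm tmp}>0$ and $\varepsilon_k=0$ otherwise; let $\varepsilon_k'=1$ if $P_T-(P_k^{\rm tmp})^+>0$ and $\varepsilon_k'=0$ otherwise. Leader's problem. In the leader's problem, the numbers $\varepsilon_k,\varepsilon_k'$ and the values $\tilde P_{k'}^*$ appearing in the formulas below are held fixed while $P_0$ varies. Put $$A=N_0+\sum_{k=1}^KH_{0k}\left[P_T-\varepsilon_k'P_T+\varepsilon_k'\varepsilon_k\left(\frac1{\lambda_k}-\frac{N_0+\sum_{k'\ne k,\,k'=1}^KH_{kk'}\tilde P_{k'}^*}{H_{kk}}\right)\right],\qquad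 B=\sum_{k=1}^K\varepsilon_k'\varepsilon_k\frac{H_{0k}H_{k0}}{H_{kk}},$$ so that the leader's utility (its rate minus its power cost, with the followers' response substituted) is $$U_0(P_0,\tilde{\boldsymbol p}^* )=\ln\left(1+\frac{H_{00}P_0}{A-BP_0}\right)-\lambda_0P_0 .$$ Feasible interval. $P_0^{\min}=\max_{1\le k\le K}P_{0,k}^{\min}$ and $P_0^{\max}=\min_{1\le k\le K}P_{0,k}^{\max}$. With $$a_k=\frac{\left(\frac1{\lambda_k}-P_T\right)H_{kk}-N_0-\sum_{k'\ne k,\,k'=1}^KH_{kk'}\tilde P_{k'}^*}{H_{k0}},\qquad b_k=\frac{\frac1{\lambda_k}H_{kk}-N_0-\sum_{k'\ne k,\,k'=1}^KH_{kk'}\tilde P_{k'}^*}{H_{k0}},$$ one sets: if $P_k^{\rm tmp}>P_T$, then $P_{0,k}^{\min}=0$ and $P_{0,k}^{\max}=\min\{P_T,a_k\}$; if $0<P_k^{\rm tmp}\le P_T$, then $P_{0,k}^{\min}=\max\{0,a_k\}$ and $P_{0,k}^{\max}=\min\{P_T,b_k\}$; if $P_k^{\rm tmp}\le 0$, then $P_{0,k}^{\min}=\max\{0,b_k\}$ and $P_{0,k}^{\max}=P_T$.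
   Formalization: The roots P_0^1, P_0^2 are compared only if they lie in [P_0^min, P_0^max], since otherwise an infeasible root can have the largest utility; when C_1=0, where the root formulas are undefined, only the two endpoints are compared. *)

theory Defs
  imports Complex_Main
begin

(* User 0 is the leader (MUE); users 1..num_sue are the followers (SUEs).
   gain N i j is the channel gain from user j to the base station of user i. *)
record network =
  num_sue :: nat
  gain :: "nat \<Rightarrow> nat \<Rightarrow> real"
  noise :: real
  max_power :: real
  cost :: "nat \<Rightarrow> real"

definition sues :: "network \<Rightarrow> nat set" where
  "sues N = {1..num_sue N}"

(* Noise plus interference from the other followers at follower k;
   the leader's contribution is not included. *)
definition sue_interference :: "network \<Rightarrow> (nat \<Rightarrow> real) \<Rightarrow> nat \<Rightarrow> real" where
  "sue_interference N p k = noise N + (\<Sum>k'\<in>sues N - {k}. gain N k k' * p k')"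

definition P_tmp :: "network \<Rightarrow> real \<Rightarrow> (nat \<Rightarrow> real) \<Rightarrow> nat \<Rightarrow> real" where
  "P_tmp N P0bar p k =
     1 / cost N k - (sue_interference N p k + gain N k 0 * P0bar) / gain N k k"

definition follower_responses :: "network \<Rightarrow> real \<Rightarrow> (nat \<Rightarrow> real) \<Rightarrow> bool" where
  "follower_responses N P0bar p \<longleftrightarrow>
     (\<forall>k\<in>sues N. p k =
        max_power N - max (max_power N - max (P_tmp N P0bar p k) 0) 0)"

definition eps :: "network \<Rightarrow> real \<Rightarrow> (nat \<Rightarrow> real) \<Rightarrow> nat \<Rightarrow> real" where
  "eps N P0bar p k = (if P_tmp N P0bar p k > 0 then 1 else 0)"

definition eps' :: "network \<Rightarrow> real \<Rightarrow> (nat \<Rightarrow> real) \<Rightarrow> nat \<Rightarrow> real" where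
  "eps' N P0bar p k = (if max_power N - max (P_tmp N P0bar p k) 0 > 0 then 1 else 0)"

definition coeff_A :: "network \<Rightarrow> real \<Rightarrow> (nat \<Rightarrow> real) \<Rightarrow> real" where
  "coeff_A N P0bar p = noise N +
     (\<Sum>k\<in>sues N. gain N 0 k *
        (max_power N - eps' N P0bar p k * max_power N
         + eps' N P0bar p k * eps N P0bar p k *
             (1 / cost N k - sue_interference N p k / gain N k k)))"

definition coeff_B :: "network \<Rightarrow> real \<Rightarrow> (nat \<Rightarrow> real) \<Rightarrow> real" where
  "coeff_B N P0bar p =
     (\<Sum>k\<in>sues N. eps' N P0bar p k * eps N P0bar p k *
        (gain N 0 k * gain N k 0 / gain N k k))"

(* P0 is the optimization variable.  The current leader power P0bar enters only through the
   indicators eps and eps', which, like the responses p, stay fixed while P0 varies. *)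
definition leader_utility :: "network \<Rightarrow> real \<Rightarrow> (nat \<Rightarrow> real) \<Rightarrow> real \<Rightarrow> real" where
  "leader_utility N P0bar p P0 =
     ln (1 + gain N 0 0 * P0 / (coeff_A N P0bar p - coeff_B N P0bar p * P0)) - cost N 0 * P0"

definition bound_a :: "network \<Rightarrow> (nat \<Rightarrow> real) \<Rightarrow> nat \<Rightarrow> real" where
  "bound_a N p k =
     ((1 / cost N k - max_power N) * gain N k k - sue_interference N p k) / gain N k 0"

definition bound_b :: "network \<Rightarrow> (nat \<Rightarrow> real) \<Rightarrow> nat \<Rightarrow> real" where
  "bound_b N p k =
     (1 / cost N k * gain N k k - sue_interference N p k) / gain N k 0"

definition P0k_min :: "network \<Rightarrow> real \<Rightarrow> (nat \<Rightarrow> real) \<Rightarrow> nat \<Rightarrow> real" where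
  "P0k_min N P0bar p k =
     (if P_tmp N P0bar p k > max_power N then 0
      else if P_tmp N P0bar p k > 0 then max 0 (bound_a N p k)
      else max 0 (bound_b N p k))"

definition P0k_max :: "network \<Rightarrow> real \<Rightarrow> (nat \<Rightarrow> real) \<Rightarrow> nat \<Rightarrow> real" where
  "P0k_max N P0bar p k =
     (if P_tmp N P0bar p k > max_power N then min (max_power N) (bound_a N p k)
      else if P_tmp N P0bar p k > 0 then min (max_power N) (bound_b N p k)
      else max_power N)"

definition P0_min :: "network \<Rightarrow> real \<Rightarrow> (nat \<Rightarrow> real) \<Rightarrow> real" where
  "P0_min N P0bar p = Max (P0k_min N P0bar p ` sues N)"

definition P0_max :: "network \<Rightarrow> real \<Rightarrow> (nat \<Rightarrow> real) \<Rightarrow> real" where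
  "P0_max N P0bar p = Min (P0k_max N P0bar p ` sues N)"

definition C1 :: "network \<Rightarrow> real \<Rightarrow> (nat \<Rightarrow> real) \<Rightarrow> real" where
  "C1 N P0bar p = cost N 0 * coeff_B N P0bar p * (gain N 0 0 - coeff_B N P0bar p)"

definition C2 :: "network \<Rightarrow> real \<Rightarrow> (nat \<Rightarrow> real) \<Rightarrow> real" where
  "C2 N P0bar p = cost N 0 * coeff_A N P0bar p * (2 * coeff_B N P0bar p - gain N 0 0)"

definition C3 :: "network \<Rightarrow> real \<Rightarrow> (nat \<Rightarrow> real) \<Rightarrow> real" where
  "C3 N P0bar p = coeff_A N P0bar p * gain N 0 0 - cost N 0 * (coeff_A N P0bar p)\<^sup>2"

definition discr :: "network \<Rightarrow> real \<Rightarrow> (nat \<Rightarrow> real) \<Rightarrow> real" where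
  "discr N P0bar p = (C2 N P0bar p)\<^sup>2 - 4 * C1 N P0bar p * C3 N P0bar p"

definition P0_root1 :: "network \<Rightarrow> real \<Rightarrow> (nat \<Rightarrow> real) \<Rightarrow> real" where
  "P0_root1 N P0bar p = (- C2 N P0bar p + sqrt (discr N P0bar p)) / (2 * C1 N P0bar p)"

definition P0_root2 :: "network \<Rightarrow> real \<Rightarrow> (nat \<Rightarrow> real) \<Rightarrow> real" where
  "P0_root2 N P0bar p = (- C2 N P0bar p - sqrt (discr N P0bar p)) / (2 * C1 N P0bar p)"

(* A root that violates the constraint P0_min \<le> P0 \<le> P0_max cannot solve the constrained
   problem and may have larger utility than every feasible point, so only feasible roots are
   compared.  If C1 = 0 the root formulas are undefined and evaluate to 0 by totality of
   division; since P0_min \<ge> 0, the point 0 is feasible only if it equals P0_min, so it adds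
   no candidate. *)
definition candidates :: "network \<Rightarrow> real \<Rightarrow> (nat \<Rightarrow> real) \<Rightarrow> real set" where
  "candidates N P0bar p =
     (if discr N P0bar p < 0
      then {P0_max N P0bar p, P0_min N P0bar p}
      else {P0_max N P0bar p, P0_min N P0bar p} \<union>
           ({P0_root1 N P0bar p, P0_root2 N P0bar p} \<inter> {P0_min N P0bar p..P0_max N P0bar p}))"

definition optimal_leader_power :: "network \<Rightarrow> real \<Rightarrow> (nat \<Rightarrow> real) \<Rightarrow> real \<Rightarrow> bool" where
  "optimal_leader_power N P0bar p x \<longleftrightarrow>
     is_arg_max (leader_utility N P0bar p)
       (\<lambda>P0. P0_min N P0bar p \<le> P0 \<and> P0 \<le> P0_max N P0bar p) x"

end

theory Submission
  imports Defs "HOL-Library.Quadratic_Discriminant"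
begin

text \<open>The current leader power is feasible, and every follower that responds in the interior of
  its range keeps a nonnegative response for all feasible leader powers, so that
  \<open>A - B P\<^sub>0\<close> stays above the noise power and the utility is differentiable on the feasible interval.
  A maximizer in the interior is a zero of the derivative, whose numerator is
  \<open>C\<^sub>1 P\<^sub>0\<^sup>2 + C\<^sub>2 P\<^sub>0 + C\<^sub>3\<close>. If \<open>C\<^sub>1 = 0\<close>, then \<open>B = H\<^sub>0\<^sub>0\<close> and this numerator is increasing,
  so an interior critical point is a minimizer.\<close>

text \<open>The terms in \<open>x\<close> cancel in the quotient rule, so the logarithm has
  derivative \<open>H * A / ((A - B * x + H * x) * (A - B * x))\<close>. Subtracting
  \<open>l\<close> over that denominator leaves the quadratic whose coefficients are those of
  \<open>C1\<close>, \<open>C2\<close> and \<open>C3\<close>.\<close>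

lemma has_derivative_log_rate:
  fixes A B H l x :: real
  assumes "A - B * x > 0" "H * x \<ge> 0"
  shows "((\<lambda>x. ln (1 + H * x / (A - B * x)) - l * x) has_real_derivative
     (l * B * (H - B) * x\<^sup>2 + l * A * (2 * B - H) * x + (A * H - l * A\<^sup>2)) /
       ((A - B * x + H * x) * (A - B * x))) (at x)"
proof -
  let ?D = "A - B * x"
  have num: "?D + H * x > 0" using assms by linarith
  have arg: "1 + H * x / ?D = (?D + H * x) / ?D" using assms by (simp add: field_simps)
  have pos: "1 + H * x / ?D > 0" unfolding arg using assms num by simp
  have "((\<lambda>x. 1 + H * x / (A - B * x)) has_real_derivative
      (H * ?D - (H * x) * (0 - B)) / (?D * ?D)) (at x)"
    using assms by (auto intro!: derivative_eq_intros)
  from DERIV_diff[OF DERIV_chain2[OF DERIV_ln_divide[OF pos] this] DERIV_cmult[OF DERIV_ident, of l]]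
  have "((\<lambda>x. ln (1 + H * x / (A - B * x)) - l * x) has_real_derivative
      (H * ?D - (H * x) * (0 - B)) / (?D * ?D) / (1 + H * x / ?D) - l) (at x)"
    by (simp add: mult.commute)
  moreover have "(H * ?D - (H * x) * (0 - B)) / (?D * ?D) / (1 + H * x / ?D) =
      H * A / ((?D + H * x) * ?D)"
  proof -
    have "H * ?D - (H * x) * (0 - B) = H * A" by (simp add: algebra_simps)
    moreover have "H * A / (d * d) / (e / d) = H * A / (e * d)" if "d > 0" for d e :: real
      using that by simp
    ultimately show ?thesis unfolding arg using assms(1) by presburger
  qed
  moreover have "H * A / ((?D + H * x) * ?D) - l =
      (l * B * (H - B) * x\<^sup>2 + l * A * (2 * B - H) * x + (A * H - l * A\<^sup>2)) /
      ((?D + H * x) * ?D)"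
  proof -
    have "H * A / ((?D + H * x) * ?D) - l = (H * A - l * ((?D + H * x) * ?D)) / ((?D + H * x) * ?D)"
      using num assms(1) by (simp add: diff_divide_distrib)
    moreover have "H * A - l * ((?D + H * x) * ?D) =
        l * B * (H - B) * x\<^sup>2 + l * A * (2 * B - H) * x + (A * H - l * A\<^sup>2)"
      by (simp add: algebra_simps power2_eq_square)
    ultimately show ?thesis by simp
  qed
  ultimately show ?thesis by simp
qed

text \<open>Compactness gives a maximizer, and Fermat's theorem makes an interior one a root. The
  conclusion carries \<open>c1 \<noteq> 0\<close> so that the quadratic formula applies to this
  root.\<close>

lemma log_rate_maximizer:
  fixes A B H l lo hi :: real
  defines "f \<equiv> \<lambda>x. ln (1 + H * x / (A - B * x)) - l * x"
    and "c1 \<equiv> l * B * (H - B)" and "c2 \<equiv> l * A * (2 * B - H)" and "c3 \<equiv> A * H - l * A\<^sup>2"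
  assumes pos: "B > 0" "H > 0" "l > 0" "0 \<le> lo" "A - B * hi > 0" and "lo \<le> hi"
  obtains x where "lo \<le> x" "x \<le> hi" "\<And>y. lo \<le> y \<Longrightarrow> y \<le> hi \<Longrightarrow> f y \<le> f x"
    "x = lo \<or> x = hi \<or> c1 \<noteq> 0 \<and> c1 * x\<^sup>2 + c2 * x + c3 = 0"
proof -
  define f' where "f' x = (c1 * x\<^sup>2 + c2 * x + c3) / ((A - B * x + H * x) * (A - B * x))" for x
  \<comment> \<open>\<open>A - B * x\<close> decreases in \<open>x\<close>, so its sign at
    \<open>hi\<close> settles it on the whole interval.\<close>
  have den: "A - B * x > 0" if "x \<le> hi" for x
    using mult_left_mono[OF that, of B] pos by linarith
  have num: "A - B * x + H * x > 0" if "lo \<le> x" "x \<le> hi" for x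
    using den[OF that(2)] mult_nonneg_nonneg[of H x] that pos by linarith
  have der: "(f has_real_derivative f' x) (at x)" if "lo \<le> x" "x \<le> hi" for x
    unfolding f_def f'_def c1_def c2_def c3_def
    by (rule has_derivative_log_rate) (use den that pos in auto)
  have cont: "continuous_on {lo..hi} f"
    by (auto intro!: DERIV_continuous_on[of _ _ f'] DERIV_subset[OF der])
  obtain x where x: "lo \<le> x" "x \<le> hi" "\<And>y. lo \<le> y \<Longrightarrow> y \<le> hi \<Longrightarrow> f y \<le> f x"
    using continuous_attains_sup[of "{lo..hi}" f] cont \<open>lo \<le> hi\<close> by auto
  have "c1 \<noteq> 0 \<and> c1 * x\<^sup>2 + c2 * x + c3 = 0" if int: "lo < x" "x < hi"
  proof -
    have "f' x = 0"
    proof (rule DERIV_local_max[OF der])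
      \<comment> \<open>The radius is the distance to the nearer endpoint, so the neighbourhood
        stays inside the interval.\<close>
      show "0 < min (x - lo) (hi - x)" using int by simp
      show "\<forall>y. \<bar>x - y\<bar> < min (x - lo) (hi - x) \<longrightarrow> f y \<le> f x"
        using x(3) by (auto simp: abs_less_iff)
    qed (use x in auto)
    then have root: "c1 * x\<^sup>2 + c2 * x + c3 = 0"
      using den[OF x(2)] num[OF x(1,2)] by (simp add: f'_def)
    moreover have "c1 \<noteq> 0"
    proof
      assume "c1 = 0"
      then have "H = B" using pos by (simp add: c1_def)
      \<comment> \<open>With \<open>H = B\<close>, the coefficient \<open>c2\<close> reduces to
        \<open>l * A * B\<close>; its sign rests on \<open>A > B * lo \<ge> 0\<close>.\<close>
      have "A > 0" using den[OF \<open>lo \<le> hi\<close>] mult_nonneg_nonneg[of B lo] pos by linarith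
      then have "c2 > 0" using pos \<open>H = B\<close> by (simp add: c2_def)
      have "f x < f hi"
      \<comment> \<open>The derivative vanishes at \<open>x\<close> itself, so its positivity is
        claimed only to the right of \<open>x\<close>; continuity covers the endpoints.\<close>
      proof (rule DERIV_pos_imp_increasing_open[OF int(2)])
        fix y assume y: "x < y" "y < hi"
        have "c2 * y + c3 > 0"
          using root \<open>c1 = 0\<close> mult_strict_left_mono[OF y(1) \<open>c2 > 0\<close>] by simp
        then have "f' y > 0"
          using den[of y] num[of y] y x \<open>c1 = 0\<close> by (simp add: f'_def)
        then show "\<exists>d. (f has_real_derivative d) (at y) \<and> d > 0"
          using der[of y] x y by auto
      next
        show "continuous_on {x..hi} f"
          using cont by (rule continuous_on_subset) (use x in auto)
      qed
      then show False using x(3)[of hi] \<open>lo \<le> hi\<close> by simp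
    qed
    ultimately show ?thesis by simp
  qed
  then have "x = lo \<or> x = hi \<or> c1 \<noteq> 0 \<and> c1 * x\<^sup>2 + c2 * x + c3 = 0"
    using x(1,2) by linarith
  with x show thesis by (rule that)
qed

locale stackelberg_network =
  fixes N :: network and P0bar :: real and p :: "nat \<Rightarrow> real"
  assumes num_sue: "num_sue N \<ge> 1"
    and gain: "\<And>i j. i \<le> num_sue N \<Longrightarrow> j \<le> num_sue N \<Longrightarrow> gain N i j > 0"
    and noise: "noise N > 0"
    and max_power: "max_power N > 0"
    and P0bar: "0 \<le> P0bar" "P0bar \<le> max_power N"
begin

lemma finite_sues: "finite (sues N)" and sues_nonempty: "sues N \<noteq> {}"
  using num_sue by (auto simp: sues_def)

lemma gain_sues:
  assumes "k \<in> sues N"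
  shows "gain N 0 k > 0" "gain N k 0 > 0" "gain N k k > 0"
  using assms gain by (auto simp: sues_def)

text \<open>\<open>P_tmp\<close> is affine and strictly decreasing in the leader power, and
  \<open>bound_b\<close> is its zero.\<close>

lemma P_tmp_pos_iff:
  assumes "k \<in> sues N"
  shows "P_tmp N x p k > 0 \<longleftrightarrow> x < bound_b N p k"
  using gain_sues[OF assms] unfolding P_tmp_def bound_b_def
  by (simp add: pos_less_divide_eq pos_divide_less_eq) (simp add: algebra_simps)

lemma P_tmp_nonneg_iff:
  assumes "k \<in> sues N"
  shows "P_tmp N x p k \<ge> 0 \<longleftrightarrow> x \<le> bound_b N p k"
  using gain_sues[OF assms] unfolding P_tmp_def bound_b_def
  by (simp add: pos_le_divide_eq pos_divide_le_eq) (simp add: algebra_simps)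

text \<open>By the same monotonicity, \<open>bound_a\<close> is the leader power at which
  \<open>P_tmp\<close> equals \<open>max_power\<close>.\<close>

lemma P_tmp_gt_max_power_iff:
  assumes "k \<in> sues N"
  shows "P_tmp N x p k > max_power N \<longleftrightarrow> x < bound_a N p k"
proof -
  have "P_tmp N x p k > max_power N \<longleftrightarrow>
      (sue_interference N p k + gain N k 0 * x) / gain N k k < 1 / cost N k - max_power N"
    unfolding P_tmp_def by linarith
  also have "\<dots> \<longleftrightarrow> x < bound_a N p k"
    using gain_sues[OF assms] unfolding bound_a_def pos_divide_less_eq[OF gain_sues(3)[OF assms]]
      pos_less_divide_eq[OF gain_sues(2)[OF assms]] by (simp add: algebra_simps)
  finally show ?thesis .
qed

lemma P0_min_nonneg: "P0_min N P0bar p \<ge> 0"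
proof -
  obtain k where k: "k \<in> sues N" using sues_nonempty by auto
  have "0 \<le> P0k_min N P0bar p k" by (simp add: P0k_min_def)
  also have "\<dots> \<le> P0_min N P0bar p" unfolding P0_min_def using k finite_sues by simp
  finally show ?thesis .
qed

text \<open>The bounds for follower \<open>k\<close> delimit, up to closure, the leader powers in
  the admissible range that keep \<open>k\<close> in its current regime (saturated, interior or
  silent), and \<open>P0bar\<close> is one of them. In particular the feasible interval is
  nonempty.\<close>

lemma P0bar_feasible: "P0_min N P0bar p \<le> P0bar" "P0bar \<le> P0_max N P0bar p"
proof -
  have "P0k_min N P0bar p k \<le> P0bar \<and> P0bar \<le> P0k_max N P0bar p k" if "k \<in> sues N" for k
    using P_tmp_pos_iff[OF that, of P0bar] P_tmp_nonneg_iff[OF that, of P0bar]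
      P_tmp_gt_max_power_iff[OF that, of P0bar] P0bar max_power
    by (auto simp: P0k_min_def P0k_max_def)
  then show "P0_min N P0bar p \<le> P0bar" "P0bar \<le> P0_max N P0bar p"
    unfolding P0_min_def P0_max_def using finite_sues sues_nonempty by auto
qed

text \<open>The left side is the noise plus the power received from the followers with regimes
  frozen: follower \<open>k\<close> sends \<open>max_power\<close> if \<open>eps'\<close> is 0,
  nothing if only \<open>eps\<close> is 0, and \<open>P_tmp N x p k\<close> if both are 1.\<close>

lemma interference_ge_noise:
  assumes "x \<le> P0_max N P0bar p"
  shows "coeff_A N P0bar p - coeff_B N P0bar p * x \<ge> noise N"
proof -
  have term_nonneg: "gain N 0 k * (max_power N - eps' N P0bar p k * max_power N
         + eps' N P0bar p k * eps N P0bar p k * (1 / cost N k - sue_interference N p k / gain N k k))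
      - eps' N P0bar p k * eps N P0bar p k * (gain N 0 k * gain N k 0 / gain N k k) * x \<ge> 0"
    (is "?t \<ge> 0") if k: "k \<in> sues N" for k
  proof (cases "eps' N P0bar p k * eps N P0bar p k = 0")
    case True
    moreover have "max_power N - eps' N P0bar p k * max_power N \<ge> 0"
      using max_power by (simp add: eps'_def)
    ultimately show ?thesis unfolding True using gain_sues[OF k] by simp
  next
    case False
    then have int: "0 < P_tmp N P0bar p k" "P_tmp N P0bar p k \<le> max_power N"
      and one: "eps' N P0bar p k = 1" "eps N P0bar p k = 1"
      by (auto simp: eps_def eps'_def split: if_splits)
    have "P0_max N P0bar p \<le> P0k_max N P0bar p k"
      unfolding P0_max_def using k finite_sues by simp
    \<comment> \<open>In the interior regime the upper limit is capped by the zero of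
      \<open>P_tmp\<close>. Equality may occur, so strict positivity has to come from the
      noise.\<close>
    also have "\<dots> \<le> bound_b N p k" using int by (simp add: P0k_max_def)
    finally have "P_tmp N x p k \<ge> 0" using assms P_tmp_nonneg_iff[OF k] by simp
    moreover have "?t = gain N 0 k * P_tmp N x p k"
      unfolding one P_tmp_def by (simp add: algebra_simps add_divide_distrib)
    ultimately show ?thesis using gain_sues[OF k] by simp
  qed
  show ?thesis
    using sum_nonneg[OF term_nonneg, of "sues N"]
    by (simp add: coeff_A_def coeff_B_def sum_subtractf sum_distrib_right)
qed

text \<open>The nonzero sum supplies a follower in the interior regime; its term in \<open>B\<close>
  is positive and all others are nonnegative.\<close>

lemma coeff_B_pos:
  assumes "(\<Sum>k\<in>sues N. eps N P0bar p k * eps' N P0bar p k) \<noteq> 0"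
  shows "coeff_B N P0bar p > 0"
proof -
  obtain k where k: "k \<in> sues N" "eps N P0bar p k * eps' N P0bar p k \<noteq> 0"
    using assms by (rule sum.not_neutral_contains_not_neutral)
  have "eps' N P0bar p j * eps N P0bar p j * (gain N 0 j * gain N j 0 / gain N j j) \<ge> 0"
    if "j \<in> sues N" for j
    using gain_sues[OF that] by (simp add: eps_def eps'_def)
  moreover have "eps' N P0bar p k * eps N P0bar p k = 1"
    using k(2) by (simp add: eps_def eps'_def split: if_splits)
  then have "eps' N P0bar p k * eps N P0bar p k * (gain N 0 k * gain N k 0 / gain N k k) > 0"
    using gain_sues[OF k(1)] by simp
  ultimately show ?thesis
    unfolding coeff_B_def by (intro sum_pos2[OF finite_sues k(1)])
qed

end

text \<open>A real root excludes the branch of \<open>candidates\<close> with negative discriminant,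
  so the roots are among the points compared there.\<close>

lemma quadratic_root_candidates:
  assumes "C1 N P0bar p \<noteq> 0" "C1 N P0bar p * x\<^sup>2 + C2 N P0bar p * x + C3 N P0bar p = 0"
  shows "discr N P0bar p \<ge> 0" "x = P0_root1 N P0bar p \<or> x = P0_root2 N P0bar p"
  using assms discriminant_iff[of "C1 N P0bar p" x "C2 N P0bar p" "C3 N P0bar p"]
  by (auto simp: discrim_def discr_def P0_root1_def P0_root2_def)

text \<open>Once some candidate \<open>c\<close> is globally maximal, every best candidate is at
  least as good as \<open>c\<close>, hence globally maximal too. This covers ties.\<close>

lemma is_arg_max_dominating_subset:
  fixes f :: "'a \<Rightarrow> real"
  assumes "\<And>y. Q y \<Longrightarrow> P y" "Q c" "\<And>y. P y \<Longrightarrow> f y \<le> f c" "is_arg_max f Q x"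
  shows "is_arg_max f P x"
proof -
  have "f c \<le> f x" using assms(2,4) by (simp add: is_arg_max_def not_less)
  then have "f y \<le> f x" if "P y" for y using assms(3)[OF that] by linarith
  moreover have "P x" using assms(1,4) by (simp add: is_arg_max_def)
  ultimately show ?thesis by (simp add: is_arg_max_def not_less)
qed

theorem theorem2:
  fixes N :: network and P0bar :: real and p :: "nat \<Rightarrow> real"
  assumes "num_sue N \<ge> 1"
    and "\<And>i j. i \<le> num_sue N \<Longrightarrow> j \<le> num_sue N \<Longrightarrow> gain N i j > 0"
    and "noise N > 0"
    and "max_power N > 0"
    and "\<And>i. i \<le> num_sue N \<Longrightarrow> cost N i > 0"
    and "0 \<le> P0bar" and "P0bar \<le> max_power N"
    and "follower_responses N P0bar p"
    and "(\<Sum>k=1..num_sue N. eps N P0bar p k * eps' N P0bar p k) \<noteq> 0"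
  shows "(\<exists>x. is_arg_max (leader_utility N P0bar p) (\<lambda>y. y \<in> candidates N P0bar p) x) \<and>
         (\<forall>x. is_arg_max (leader_utility N P0bar p) (\<lambda>y. y \<in> candidates N P0bar p) x \<longrightarrow>
              optimal_leader_power N P0bar p x)"
proof -
  interpret stackelberg_network N P0bar p
    by unfold_locales (use assms in auto)
  let ?lo = "P0_min N P0bar p" and ?hi = "P0_max N P0bar p" and ?f = "leader_utility N P0bar p"
  have le: "?lo \<le> ?hi" using P0bar_feasible by linarith
  have "coeff_B N P0bar p > 0" using coeff_B_pos assms(9) by (simp add: sues_def)
  moreover have "coeff_A N P0bar p - coeff_B N P0bar p * ?hi > 0"
    using interference_ge_noise[OF order_refl] noise by linarith
  ultimately obtain c where c: "?lo \<le> c" "c \<le> ?hi" "\<And>y. ?lo \<le> y \<Longrightarrow> y \<le> ?hi \<Longrightarrow> ?f y \<le> ?f c"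
    "c = ?lo \<or> c = ?hi \<or>
      C1 N P0bar p \<noteq> 0 \<and> C1 N P0bar p * c\<^sup>2 + C2 N P0bar p * c + C3 N P0bar p = 0"
    using log_rate_maximizer[of "coeff_B N P0bar p" "gain N 0 0" "cost N 0" ?lo
        "coeff_A N P0bar p" ?hi] gain[of 0 0] assms(5)[of 0] P0_min_nonneg le
    unfolding leader_utility_def C1_def C2_def C3_def by blast
  \<comment> \<open>If \<open>c\<close> is a root, its feasibility lets it survive the intersection
    with the interval in \<open>candidates\<close>.\<close>
  have cand: "c \<in> candidates N P0bar p"
    using c(1,2,4) quadratic_root_candidates[of N P0bar p c] by (auto simp: candidates_def)
  have feasible: "?lo \<le> y \<and> y \<le> ?hi" if "y \<in> candidates N P0bar p" for y
    using that le by (auto simp: candidates_def split: if_splits)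
  have "is_arg_max ?f (\<lambda>y. y \<in> candidates N P0bar p) c"
    using cand c(3) feasible by (simp add: is_arg_max_def not_less)
  moreover have "optimal_leader_power N P0bar p x"
    if "is_arg_max ?f (\<lambda>y. y \<in> candidates N P0bar p) x" for x
    unfolding optimal_leader_power_def
    by (rule is_arg_max_dominating_subset[OF _ cand _ that]) (use feasible c(3) in auto)
  ultimately show ?thesis by blast
qed

end
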